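(* Let $\mathfrak a_{n,m}$ be the number of $\sigma\in\mathcal{I}_n(010,120)$ with $\max(\sigma)=m$, and let $\mathfrak b_{n,k}=|\mathcal W_{n,k}(010,120)|$. Then for all integers $0<m<n$, $$\mathfrak a_{n,m}=\sum_{p=m+1}^{n}\sum_{j=0}^{m-1}\mathfrak a_{p-1,j}\,\mathfrak b_{n-p,m-j}.$$
   Context: For $n\in\mathbb N$, an inversion sequence of size $n$ is a sequence $\sigma=(\sigma_1,\dots,\sigma_n)\in\mathbb N^n$ with $\sigma_i<i$ for all $i$. An integer sequence contains a pattern $\rho$ (a finite integer sequence such as $010$ or $120$) if it has a subsequence order-isomorphic to $\rho$, and avoids $\rho$ otherwise. $\mathcal{I}_n(P)$ denotes the set of inversion sequences of size $n$ avoiding every pattern in the set $P$. $\mathcal W_{n,k}=\{0,\dots,k-1\}^n$ is the set of words of length $n$ over $\{0,\dots,k-1\}$, and $\mathcal W_{n,k}(P)$ its subset of words avoiding every pattern in $P$. $\max(\sigma)$ is the largest entry of $\sigma$. *)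

theory Defs
  imports Main "HOL-Library.Sublist"
begin

definition order_isomorphic :: "'a::linorder list \<Rightarrow> 'b::linorder list \<Rightarrow> bool" where
  "order_isomorphic xs ys \<longleftrightarrow> length xs = length ys \<and>
     (\<forall>i < length xs. \<forall>j < length xs. xs ! i < xs ! j \<longleftrightarrow> ys ! i < ys ! j)"

(* subseq is the library's notion of a not necessarily contiguous subsequence. *)
definition contains_pattern :: "'a::linorder list \<Rightarrow> 'b::linorder list \<Rightarrow> bool" where
  "contains_pattern xs \<rho> \<longleftrightarrow> (\<exists>ys. subseq ys xs \<and> order_isomorphic ys \<rho>)"

definition avoids_all :: "'a::linorder list \<Rightarrow> 'b::linorder list set \<Rightarrow> bool" where
  "avoids_all xs P \<longleftrightarrow> (\<forall>\<rho>\<in>P. \<not> contains_pattern xs \<rho>)"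

(* List positions start at 0, so the condition that the i-th entry (i = 1, ..., n)
   is smaller than i reads \<sigma> ! i < Suc i for i < n. *)
definition inversion_sequences :: "nat \<Rightarrow> nat list set" where
  "inversion_sequences n = {\<sigma>. length \<sigma> = n \<and> (\<forall>i < n. \<sigma> ! i < Suc i)}"

definition inversion_sequences_avoiding :: "nat \<Rightarrow> nat list set \<Rightarrow> nat list set" where
  "inversion_sequences_avoiding n P = {\<sigma> \<in> inversion_sequences n. avoids_all \<sigma> P}"

definition words :: "nat \<Rightarrow> nat \<Rightarrow> nat list set" where
  "words n k = {w. length w = n \<and> set w \<subseteq> {0..<k}}"

definition words_avoiding :: "nat \<Rightarrow> nat \<Rightarrow> nat list set \<Rightarrow> nat list set" where
  "words_avoiding n k P = {w \<in> words n k. avoids_all w P}"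

(* For n = 0 the only sequence is [], whose maximum Max {} is unspecified;
   the numbers a_count 0 m carry no meaning. *)
definition a_count :: "nat \<Rightarrow> nat \<Rightarrow> nat" where
  "a_count n m =
     card {\<sigma> \<in> inversion_sequences_avoiding n {[0, 1, 0], [1, 2, 0]}. Max (set \<sigma>) = m}"

definition b_count :: "nat \<Rightarrow> nat \<Rightarrow> nat" where
  "b_count n k = card (words_avoiding n k {[0, 1, 0], [1, 2, 0]})"

end

theory Submission
  imports Defs
begin

text \<open>
  Split a sequence at the first occurrence of its maximum \<open>m\<close>, at position \<open>p\<close>, and let \<open>j\<close> be
  the maximum of the prefix. Since \<open>j\<close> and \<open>m\<close> precede the suffix, a suffix entry below \<open>j\<close>
  would create \<open>120\<close> and one equal to \<open>j\<close> would create \<open>010\<close>, so the suffix is an avoiding word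
  over \<open>{j + 1..m}\<close>. Conversely, no pattern can straddle the split, and the suffix satisfies the
  inversion condition because all its positions exceed \<open>m\<close>.
\<close>

lemma order_isomorphic_triple:
  fixes x y z :: "'b::linorder"
  shows "order_isomorphic xs [x, y, z] \<longleftrightarrow>
    (\<exists>a b c. xs = [a, b, c] \<and> (a < b \<longleftrightarrow> x < y) \<and> (b < a \<longleftrightarrow> y < x) \<and>
      (a < c \<longleftrightarrow> x < z) \<and> (c < a \<longleftrightarrow> z < x) \<and> (b < c \<longleftrightarrow> y < z) \<and> (c < b \<longleftrightarrow> z < y))"
proof (cases "\<exists>a b c. xs = [a, b, c]")
  case True
  then show ?thesis
    by (elim exE) (simp add: order_isomorphic_def All_less_Suc, blast)
next
  case False
  then have "length xs \<noteq> length [x, y, z]"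
    by (auto simp: length_Suc_conv)
  then show ?thesis
    using False unfolding order_isomorphic_def by blast
qed

text \<open>After an ascent \<open>a < b\<close>, a later \<open>c = a\<close> gives 010 and a later
  \<open>c < a\<close> gives 120. Forbidding both leaves only \<open>a < c\<close>, so a single
  condition on triples replaces the two patterns.\<close>

lemma avoids_010_120_iff:
  fixes xs :: "'a::linorder list"
  shows "avoids_all xs {[0, 1, 0], [1, 2, 0::nat]} \<longleftrightarrow>
    (\<forall>a b c. subseq [a, b, c] xs \<longrightarrow> a < b \<longrightarrow> a < c)"
proof -
  have "contains_pattern xs [0, 1, 0::nat] \<longleftrightarrow> (\<exists>a b c. subseq [a, b, c] xs \<and> a < b \<and> a = c)"
    unfolding contains_pattern_def order_isomorphic_triple
    by (fastforce simp: not_less_iff_gr_or_eq)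
  moreover have "contains_pattern xs [1, 2, 0::nat] \<longleftrightarrow>
      (\<exists>a b c. subseq [a, b, c] xs \<and> a < b \<and> c < a)"
    unfolding contains_pattern_def order_isomorphic_triple
    by (fastforce dest: less_trans less_asym)
  ultimately have "avoids_all xs {[0, 1, 0], [1, 2, 0::nat]} \<longleftrightarrow>
      \<not> (\<exists>a b c. subseq [a, b, c] xs \<and> a < b \<and> (a = c \<or> c < a))"
    unfolding avoids_all_def by blast
  then show ?thesis
    by (metis less_linear less_irrefl less_asym)
qed

text \<open>For \<open>x\<close> in \<alpha> and \<open>y\<close> in \<beta>, the triple
  \<open>x, m, y\<close> begins with an ascent, which forces \<open>x < y\<close>. Conversely, a
  triple that begins in \<alpha> and ends beyond it already has its last entry above its
  first.\<close>

lemma avoids_010_120_append_iff: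
  fixes \<alpha> \<beta> :: "'a::linorder list"
  assumes "\<And>x. x \<in> set \<alpha> \<Longrightarrow> x < m" and "\<And>y. y \<in> set \<beta> \<Longrightarrow> y \<le> m"
  shows "avoids_all (\<alpha> @ m # \<beta>) {[0, 1, 0], [1, 2, 0::nat]} \<longleftrightarrow>
    avoids_all \<alpha> {[0, 1, 0], [1, 2, 0::nat]} \<and> avoids_all \<beta> {[0, 1, 0], [1, 2, 0::nat]} \<and>
    (\<forall>x\<in>set \<alpha>. \<forall>y\<in>set \<beta>. x < y)"
    (is "?L \<longleftrightarrow> ?A \<and> ?B \<and> ?C")
proof (intro iffI conjI ballI)
  assume L: ?L
  show ?A using L unfolding avoids_010_120_iff by (meson subseq_rev_drop_many)
  show ?B using L unfolding avoids_010_120_iff by (meson list_emb_append2 list_emb_Cons)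
  fix x y assume "x \<in> set \<alpha>" "y \<in> set \<beta>"
  then have "subseq ([x] @ [m, y]) (\<alpha> @ m # \<beta>)"
    by (intro list_emb_append_mono) (auto simp: subseq_singleton_left)
  with L assms(1)[OF \<open>x \<in> set \<alpha>\<close>] show "x < y"
    unfolding avoids_010_120_iff by auto
next
  assume R: "?A \<and> ?B \<and> ?C"
  show ?L
    unfolding avoids_010_120_iff
  proof (intro allI impI)
    fix a b c assume s: "subseq [a, b, c] (\<alpha> @ m # \<beta>)" and "a < b"
    have A: "subseq [a, b, c] \<alpha> \<Longrightarrow> a < c" and B: "subseq [a, b, c] \<beta> \<Longrightarrow> a < c"
      using R \<open>a < b\<close> unfolding avoids_010_120_iff by blast+
    from s obtain us vs where eq: "[a, b, c] = us @ vs"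
      and u: "subseq us \<alpha>" and v: "subseq vs (m # \<beta>)"
      by (auto simp: subseq_append_iff)
    have us: "set us \<subseteq> set \<alpha>" and vs: "set vs \<subseteq> set (m # \<beta>)"
      using u v by (blast elim: list_emb_set)+
    show "a < c"
    proof (cases us)
      case Nil
      \<comment> \<open>The triple lies in \<open>m # \<beta>\<close>. It cannot start with
        \<open>m\<close>, since \<open>b \<le> m\<close> would contradict \<open>a < b\<close>;
        hence it lies in \<beta>.\<close>
      then have "vs = [a, b, c]" using eq by simp
      then show ?thesis using v vs B \<open>a < b\<close> assms(2)
        by (auto split: if_splits) (meson leD)+
    next
      case (Cons u us')
      then have a: "a \<in> set \<alpha>" using eq us by auto
      show ?thesis
      proof (cases "vs = []")
        case True
        then show ?thesis using A u eq by simp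
      next
        case False
        \<comment> \<open>As \<open>vs\<close> is a nonempty final part of the triple, it contains
          \<open>c\<close>. Either \<open>c = m\<close>, which exceeds all of \<alpha>, or
          \<open>c\<close> is in \<beta>, where the third conjunct applies.\<close>
        then have "c \<in> set (m # \<beta>)" using eq vs
          by (metis append.right_neutral last_appendR last.simps last_in_set list.distinct(1) subsetD)
        then show ?thesis using a R assms(1) by auto
      qed
    qed
  qed
qed

text \<open>Translation preserves order. This carries suffixes with values in
  \<open>{j + 1..m}\<close> to words over an alphabet starting at 0.\<close>

lemma avoids_010_120_map_add:
  fixes xs :: "nat list"
  shows "avoids_all (map (\<lambda>x. x + k) xs) {[0, 1, 0], [1, 2, 0::nat]} \<longleftrightarrow>
    avoids_all xs {[0, 1, 0], [1, 2, 0::nat]}" (is "?L \<longleftrightarrow> ?R")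
proof
  assume L: ?L
  show ?R unfolding avoids_010_120_iff
  proof (intro allI impI)
    fix a b c assume "subseq [a, b, c] xs" "a < b"
    then have "subseq [a + k, b + k, c + k] (map (\<lambda>x. x + k) xs)" and "a + k < b + k"
      using subseq_map[of "[a, b, c]" xs "\<lambda>x. x + k"] by auto
    then have "a + k < c + k"
      using L unfolding avoids_010_120_iff by blast
    then show "a < c" by simp
  qed
next
  assume R: ?R
  show ?L unfolding avoids_010_120_iff
  proof (intro allI impI)
    fix a b c assume s: "subseq [a, b, c] (map (\<lambda>x. x + k) xs)" and "a < b"
    \<comment> \<open>All three entries are at least \<open>k\<close>, so the truncated subtraction
      of \<open>k\<close> preserves their order.\<close>
    have "set [a, b, c] \<subseteq> (\<lambda>x. x + k) ` set xs"
      using list_emb_set[OF s] by (metis image_set subsetI)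
    moreover have "subseq (map (\<lambda>x. x - k) [a, b, c]) (map (\<lambda>x. x - k) (map (\<lambda>x. x + k) xs))"
      using s by (rule subseq_map)
    ultimately show "a < c" using R \<open>a < b\<close> unfolding avoids_010_120_iff
      by (auto simp: o_def)
  qed
qed

lemma finite_inversion_sequences: "finite (inversion_sequences n)"
proof (rule finite_subset)
  show "inversion_sequences n \<subseteq> {\<sigma>. set \<sigma> \<subseteq> {..<n} \<and> length \<sigma> = n}"
    by (fastforce simp: inversion_sequences_def in_set_conv_nth)
qed (rule finite_lists_length_eq, simp)

lemma finite_words: "finite (words n k)"
  using finite_lists_length_eq[of "{0..<k}" n] by (simp add: words_def conj_commute)

text \<open>Counting positions from 0, \<open>m\<close> stands at position
  \<open>length \<alpha>\<close>, where the bound reads \<open>m \<le> length \<alpha>\<close>.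
  Every later entry is at most \<open>m\<close> and has a weaker bound.\<close>

lemma inversion_sequences_append_iff:
  assumes "\<And>y. y \<in> set \<beta> \<Longrightarrow> y \<le> m"
  shows "\<alpha> @ m # \<beta> \<in> inversion_sequences n \<longleftrightarrow>
    \<alpha> \<in> inversion_sequences (length \<alpha>) \<and> m \<le> length \<alpha> \<and> n = Suc (length \<alpha> + length \<beta>)"
proof -
  have "(\<forall>i < Suc (length \<alpha> + length \<beta>). (\<alpha> @ m # \<beta>) ! i < Suc i) \<longleftrightarrow>
      (\<forall>i < length \<alpha>. \<alpha> ! i < Suc i) \<and> m \<le> length \<alpha>" (is "?L \<longleftrightarrow> ?R")
  proof
    assume L: ?L
    have "\<alpha> ! i < Suc i" if "i < length \<alpha>" for i
      using L[rule_format, of i] that by (simp add: nth_append)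
    moreover have "m \<le> length \<alpha>" using L[rule_format, of "length \<alpha>"] by simp
    ultimately show ?R by blast
  next
    assume R: ?R
    have "(\<alpha> @ m # \<beta>) ! i \<le> m" if "length \<alpha> \<le> i" "i < Suc (length \<alpha> + length \<beta>)" for i
    proof -
      have "(\<alpha> @ m # \<beta>) ! i = (m # \<beta>) ! (i - length \<alpha>)" using that by (simp add: nth_append)
      also have "\<dots> \<in> set (m # \<beta>)" using that by (intro nth_mem) auto
      finally show ?thesis using assms by auto
    qed
    then show ?L using R by (force simp: nth_append not_less)
  qed
  then show ?thesis by (auto simp: inversion_sequences_def)
qed

lemma Max_append_Cons:
  fixes m :: "'a::linorder"
  assumes "\<And>x. x \<in> set \<alpha> \<Longrightarrow> x < m" and "\<And>y. y \<in> set \<beta> \<Longrightarrow> y \<le> m"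
  shows "Max (set (\<alpha> @ m # \<beta>)) = m"
  using assms by (intro Max_eqI) (auto intro: less_imp_le)

text \<open>The first occurrence of \<open>x\<close> determines where the list is cut; this gives
  injectivity of the decomposition below.\<close>

lemma append_Cons_eq_iff_first:
  assumes "x \<notin> set xs" and "x \<notin> set xs'"
  shows "xs @ x # ys = xs' @ x # ys' \<longleftrightarrow> xs = xs' \<and> ys = ys'"
  using assms by (auto simp: append_eq_append_conv2 append_eq_Cons_conv Cons_eq_append_conv)

text \<open>Here \<open>p\<close> is the position counted from 1, so the prefix has length
  \<open>p - 1\<close> and the inversion condition at the maximum is \<open>p \<ge> m + 1\<close>.
  The suffix takes values in \<open>{j + 1..m}\<close>, hence the alphabet size \<open>m - j\<close>
  and the shift by \<open>Suc j\<close>.\<close>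

lemma bij_betw_first_maximum:
  assumes "0 < m" and "0 < n"
  defines "P \<equiv> {[0, 1, 0], [1, 2, 0::nat]}"
  shows "bij_betw (\<lambda>(p, j, \<alpha>, \<beta>). \<alpha> @ m # map (\<lambda>x. x + Suc j) \<beta>)
    (SIGMA p:{m + 1..n}. SIGMA j:{0..m - 1}.
      {\<alpha> \<in> inversion_sequences_avoiding (p - 1) P. Max (set \<alpha>) = j} \<times>
      words_avoiding (n - p) (m - j) P)
    {\<sigma> \<in> inversion_sequences_avoiding n P. Max (set \<sigma>) = m}"
    (is "bij_betw ?f ?S ?T")
proof -
  have S: "length \<alpha> = p - 1 \<and> m < p \<and> p \<le> n \<and> Max (set \<alpha>) = j \<and> (\<forall>x\<in>set \<alpha>. x \<le> j) \<and> j < m \<and>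
      (\<forall>y\<in>set \<beta>. j + Suc y \<le> m)"
    if "(p, j, \<alpha>, \<beta>) \<in> ?S" for p j \<alpha> \<beta>
    using that assms(1)
    by (fastforce simp: inversion_sequences_avoiding_def inversion_sequences_def
        words_avoiding_def words_def)
  have "inj_on ?f ?S"
  proof (rule inj_onI)
    fix s s'
    assume "s \<in> ?S" "s' \<in> ?S" "?f s = ?f s'"
    moreover obtain p j \<alpha> \<beta> p' j' \<alpha>' \<beta>' where s: "s = (p, j, \<alpha>, \<beta>)" "s' = (p', j', \<alpha>', \<beta>')"
      by (metis prod_cases4)
    ultimately have 1: "(p, j, \<alpha>, \<beta>) \<in> ?S" and 2: "(p', j', \<alpha>', \<beta>') \<in> ?S"
      and eq: "\<alpha> @ m # map (\<lambda>x. x + Suc j) \<beta> = \<alpha>' @ m # map (\<lambda>x. x + Suc j') \<beta>'"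
      by simp_all
    note S1 = S[OF 1] and S2 = S[OF 2]
    have "m \<notin> set \<alpha>" "m \<notin> set \<alpha>'" using S1 S2 by auto
    then have \<alpha>: "\<alpha> = \<alpha>'" and \<beta>: "map (\<lambda>x. x + Suc j) \<beta> = map (\<lambda>x. x + Suc j') \<beta>'"
      using eq by (simp_all add: append_Cons_eq_iff_first)
    \<comment> \<open>The prefix determines \<open>j\<close> as its maximum and \<open>p\<close> by
      its length; with equal shifts the words then agree too.\<close>
    have j: "j = j'" using S1 S2 \<alpha> by auto
    have "p = p'" using S1 S2 \<alpha> by auto
    moreover have "\<beta> = \<beta>'"
      using \<beta> unfolding j by (rule map_injective) (auto intro: injI)
    ultimately show "s = s'" using s \<alpha> j by simp
  qed
  moreover have "?f ` ?S \<subseteq> ?T"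
  proof (rule image_subsetI)
    fix s assume "s \<in> ?S"
    moreover obtain p j \<alpha> \<beta> where s: "s = (p, j, \<alpha>, \<beta>)" by (metis prod_cases4)
    ultimately have 1: "(p, j, \<alpha>, \<beta>) \<in> ?S" by simp
    note S1 = S[OF 1]
    let ?\<beta> = "map (\<lambda>x. x + Suc j) \<beta>"
    have lt: "x < m" if "x \<in> set \<alpha>" for x using S1 that le_less_trans by blast
    have le: "y \<le> m" if "y \<in> set ?\<beta>" for y using S1 that by auto
    have "avoids_all (\<alpha> @ m # ?\<beta>) P"
      unfolding P_def
    proof (subst avoids_010_120_append_iff, erule lt, erule le, intro conjI ballI)
      show "avoids_all \<alpha> {[0, 1, 0], [1, 2, 0::nat]}"
        using 1 by (simp add: inversion_sequences_avoiding_def P_def)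
      show "avoids_all ?\<beta> {[0, 1, 0], [1, 2, 0::nat]}"
        unfolding avoids_010_120_map_add using 1 by (simp add: words_avoiding_def P_def)
      show "x < y" if "x \<in> set \<alpha>" "y \<in> set ?\<beta>" for x y
      proof -
        have "x \<le> j" using S1 that(1) by blast
        also have "j < y" using that(2) by auto
        finally show ?thesis .
      qed
    qed
    moreover have "\<alpha> @ m # ?\<beta> \<in> inversion_sequences n"
      using 1 S1 le by (subst inversion_sequences_append_iff)
        (auto simp: inversion_sequences_avoiding_def words_avoiding_def words_def)
    moreover have "Max (set (\<alpha> @ m # ?\<beta>)) = m"
      using lt le by (rule Max_append_Cons)
    ultimately show "?f s \<in> ?T"
      by (simp add: s inversion_sequences_avoiding_def)
  qed
  moreover have "?T \<subseteq> ?f ` ?S"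
  proof
    fix \<sigma> assume "\<sigma> \<in> ?T"
    then have inv: "\<sigma> \<in> inversion_sequences n" and av: "avoids_all \<sigma> P" and max: "Max (set \<sigma>) = m"
      by (auto simp: inversion_sequences_avoiding_def)
    have le\<sigma>: "x \<le> m" if "x \<in> set \<sigma>" for x using max that by auto
    have "\<sigma> \<noteq> []"
      using inv assms(2) by (auto simp: inversion_sequences_def)
    then have "m \<in> set \<sigma>" using max Max_in[of "set \<sigma>"] by simp
    then obtain \<alpha> \<gamma> where \<sigma>: "\<sigma> = \<alpha> @ m # \<gamma>" and "m \<notin> set \<alpha>"
      using split_list_first by metis
    have lt: "x < m" if "x \<in> set \<alpha>" for x
      using that le\<sigma>[of x] \<open>m \<notin> set \<alpha>\<close> by (cases "x = m") (auto simp: \<sigma>)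
    have le: "y \<le> m" if "y \<in> set \<gamma>" for y using that le\<sigma> by (simp add: \<sigma>)
    have inv\<alpha>: "\<alpha> \<in> inversion_sequences (length \<alpha>)" and m: "m \<le> length \<alpha>"
      and n: "n = Suc (length \<alpha> + length \<gamma>)"
      using inv le by (simp_all add: \<sigma> inversion_sequences_append_iff)
    have av\<alpha>: "avoids_all \<alpha> P" and av\<gamma>: "avoids_all \<gamma> P"
      and less: "\<And>x y. x \<in> set \<alpha> \<Longrightarrow> y \<in> set \<gamma> \<Longrightarrow> x < y"
      using av lt le unfolding P_def \<sigma> by (simp_all add: avoids_010_120_append_iff del: One_nat_def)
    define j where "j = Max (set \<alpha>)"
    \<comment> \<open>Here \<open>0 < m\<close> matters: a nonempty prefix attains its maximum
      \<open>j\<close>, so \<open>less\<close> can be applied to \<open>j\<close> itself.\<close>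
    have "\<alpha> \<noteq> []" using m assms(1) by auto
    then have j: "j \<in> set \<alpha>" by (simp add: j_def)
    define \<beta> where "\<beta> = map (\<lambda>y. y - Suc j) \<gamma>"
    \<comment> \<open>Every entry of \<gamma> exceeds \<open>j\<close>, so adding
      \<open>Suc j\<close> undoes the truncated subtraction.\<close>
    have \<gamma>: "\<gamma> = map (\<lambda>x. x + Suc j) \<beta>"
      unfolding \<beta>_def map_map by (rule map_idI[symmetric]) (use less[OF j] in fastforce)
    have "\<beta> \<in> words_avoiding (n - Suc (length \<alpha>)) (m - j) P"
      using av\<gamma> le less[OF j] unfolding \<gamma> P_def avoids_010_120_map_add
      by (force simp: words_avoiding_def words_def n \<gamma>)
    then have "(Suc (length \<alpha>), j, \<alpha>, \<beta>) \<in> ?S"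
      using m n inv\<alpha> av\<alpha> lt[OF j] by (auto simp: inversion_sequences_avoiding_def j_def)
    then show "\<sigma> \<in> ?f ` ?S" by (rule rev_image_eqI) (simp add: \<sigma> \<gamma>)
  qed
  ultimately show ?thesis by (auto simp: bij_betw_def)
qed

theorem theorem15:
  fixes n m :: nat
  assumes "0 < m" and "m < n"
  shows "a_count n m =
    (\<Sum>p = m + 1..n. \<Sum>j = 0..m - 1. a_count (p - 1) j * b_count (n - p) (m - j))"
  \<comment> \<open>The bijection replaces the left side by the cardinality of the dependent sum;
    finiteness of all fibres turns this into the double sum of products.\<close>
  unfolding a_count_def b_count_def
    bij_betw_same_card[OF bij_betw_first_maximum[OF assms(1) order.strict_trans[OF assms]],
      symmetric]
  by (simp add: card_SigmaI card_cartesian_product inversion_sequences_avoiding_def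
      words_avoiding_def finite_inversion_sequences finite_words)

end
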